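(* Let $(L,[\,,\,],\alpha,[p])$ be a multiplicative restricted Hom-Lie superalgebra over $F$, let $H$ be a Hom-Lie subsuperalgebra of $L$, and let $[p]_1:H^0\to H^0$ be a map. Then the following statements are equivalent: (i) $[p]_1$ is a $p$-map on $H^0$ (that is, a $p$-map for the Hom-Lie superalgebra $(H,[\,,\,],\alpha|_H)$); (ii) there is a $p$-semilinear map $f:H^0\to C_L(H)$ such that $[p]_1=[p]+f$, i.e. $x^{[p]_1}=x^{[p]}+f(x)$ for all $x\in H^0$.
   Context: $F$ is a field of characteristic $p>0$ with $p\neq 2,3$. A linear superspace is a $\mathbb{Z}_2$-graded $F$-vector space $V=V_0\oplus V_1$; $|x|$ denotes the parity of a homogeneous element $x$; a linear map $V\to V'$ is even if it maps $V_j$ into $V'_j$ for $j=0,1$, and a bilinear map is even if it respects the grading. A Hom-Lie superalgebra is a triple $(L,[\,,\,],\alpha)$ with $L$ a linear superspace, $[\,,\,]:L\times L\to L$ an even bilinear map and $\alpha:L\to L$ an even linear map such that for all homogeneous $x,y,z$: $[x,y]=-(-1)^{|x||y|}[y,x]$ and $(-1)^{|x||z|}[\alpha(x),[y,z]]+(-1)^{|z||y|}[\alpha(z),[x,y]]+(-1)^{|y||x|}[\alpha(y),[z,x]]=0$. It is multiplicative if $\alpha([x,y])=[\alpha(x),\alpha(y)]$ for all $x,y$. A Hom-Lie subsuperalgebra is a (graded) subspace $H=H_0\oplus H_1$, $H_j\subseteq L_j$, with $\alpha(H)\subseteq H$ and $[x,y]\in H$ for all $x,y\in H$. For a multiplicative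 Hom-Lie superalgebra $L$ put $L^0=\{x\in L_0:\alpha(x)=x\}$ (similarly $H^0=\{x\in H_0:\alpha(x)=x\}$), and for $a\in L^0$ let $\mathrm{ad}_\alpha a:L\to L$, $b\mapsto[a,\alpha(b)]$. A $p$-map for $L$ is a map $[p]:L^0\to L^0$, $x\mapsto x^{[p]}$, such that (1) $(\mathrm{ad}_\alpha x)^p=\mathrm{ad}_\alpha(x^{[p]})$ on $L$ for all $x\in L^0$; (2) $(kx)^{[p]}=k^px^{[p]}$ for all $k\in F$, $x\in L^0$; (3) $(x+y)^{[p]}=x^{[p]}+y^{[p]}+\sum_{i=1}^{p-1}s_i(x,y)$ for all $x,y\in L^0$, where $i\,s_i(x,y)$ is the coefficient of $\lambda^{i-1}$ in $(\mathrm{ad}_\alpha(\lambda x+y))^{p-1}(x)$. A restricted Hom-Lie superalgebra $(L,[\,,\,],\alpha,[p])$ is a multiplicative Hom-Lie superalgebra together with a $p$-map. For a subset $S\subseteq L$, the $\alpha$-centralizer is $C_L(S)=\{x\in L:[x,\alpha(y)]=0\ \forall y\in S\}$. A map $f$ between $F$-vector spaces is $p$-semilinear if $f(kx+y)=k^pf(x)+f(y)$ for all $x,y$ and all $k\in F$. *)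

theory Defs
  imports "HOL-Library.Z2" "HOL-Computational_Algebra.Computational_Algebra"
begin

text \<open>
  A \<open>\<int>\<^sub>2\<close>-graded space is a family \<open>V :: bit \<Rightarrow> 'v set\<close> of subspaces of an ambient vector
  space whose sum is direct; the underlying space \<open>total_space V\<close> need not be the whole type, so
  that a graded subspace \<open>H\<close> of \<open>L\<close> is treated on the same footing as \<open>L\<close> itself. Maps are
  total HOL functions of which only the values on the relevant carrier matter; in particular
  the restriction of \<open>\<alpha>\<close> and of the bracket to \<open>H\<close> is written with the same \<open>\<alpha>\<close> and \<open>br\<close>.
\<close>

definition total_space :: "(bit \<Rightarrow> 'v::ab_group_add set) \<Rightarrow> 'v set" where
  "total_space V = {x + y | x y. x \<in> V 0 \<and> y \<in> V 1}"

text \<open>The sign \<open>(-1)\<close> to the power \<open>|x||y|\<close> for parities \<open>|x| = i\<close>, \<open>|y| = j\<close>.\<close>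

definition parity_sign :: "bit \<Rightarrow> bit \<Rightarrow> 'f::field" where
  "parity_sign i j = (if i * j = 1 then - 1 else 1)"

locale linear_superspace = vector_space scale
  for scale :: "'f::field \<Rightarrow> 'v::ab_group_add \<Rightarrow> 'v" (infixr \<open>*s\<close> 75) +
  fixes L :: "bit \<Rightarrow> 'v set"
  assumes subspace_component: "subspace (L i)"
    and direct: "L 0 \<inter> L 1 = {0}"

locale hom_lie_superalgebra = linear_superspace scale L
  for scale :: "'f::field \<Rightarrow> 'v::ab_group_add \<Rightarrow> 'v" (infixr \<open>*s\<close> 75)
    and L :: "bit \<Rightarrow> 'v set" +
  fixes br :: "'v \<Rightarrow> 'v \<Rightarrow> 'v" and \<alpha> :: "'v \<Rightarrow> 'v"
  assumes alpha_linear: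
      "\<lbrakk>x \<in> total_space L; y \<in> total_space L\<rbrakk> \<Longrightarrow> \<alpha> (k *s x + y) = k *s \<alpha> x + \<alpha> y"
    and alpha_even: "x \<in> L i \<Longrightarrow> \<alpha> x \<in> L i"
    and br_linear_left:
      "\<lbrakk>x \<in> total_space L; y \<in> total_space L; z \<in> total_space L\<rbrakk> \<Longrightarrow> br (k *s x + y) z = k *s br x z + br y z"
    and br_linear_right:
      "\<lbrakk>x \<in> total_space L; y \<in> total_space L; z \<in> total_space L\<rbrakk> \<Longrightarrow> br z (k *s x + y) = k *s br z x + br z y"
    and br_even: "\<lbrakk>x \<in> L i; y \<in> L j\<rbrakk> \<Longrightarrow> br x y \<in> L (i + j)"
    and br_skew: "\<lbrakk>x \<in> L i; y \<in> L j\<rbrakk> \<Longrightarrow> br x y = - (parity_sign i j *s br y x)"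
    and hom_jacobi: "\<lbrakk>x \<in> L i; y \<in> L j; z \<in> L l\<rbrakk> \<Longrightarrow>
        parity_sign i l *s br (\<alpha> x) (br y z)
      + parity_sign l j *s br (\<alpha> z) (br x y)
      + parity_sign j i *s br (\<alpha> y) (br z x) = 0"

locale multiplicative_hom_lie_superalgebra = hom_lie_superalgebra scale L br \<alpha>
  for scale :: "'f::field \<Rightarrow> 'v::ab_group_add \<Rightarrow> 'v" (infixr \<open>*s\<close> 75)
    and L br \<alpha> +
  assumes multiplicative:
    "\<lbrakk>x \<in> total_space L; y \<in> total_space L\<rbrakk> \<Longrightarrow> \<alpha> (br x y) = br (\<alpha> x) (\<alpha> y)"

locale hom_lie_subsuperalgebra = hom_lie_superalgebra scale L br \<alpha>
  for scale :: "'f::field \<Rightarrow> 'v::ab_group_add \<Rightarrow> 'v" (infixr \<open>*s\<close> 75)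
    and L br \<alpha> +
  fixes H :: "bit \<Rightarrow> 'v set"
  assumes sub_subspace: "subspace (H i)"
    and sub_component: "H i \<subseteq> L i"
    and sub_alpha: "\<alpha> ` total_space H \<subseteq> total_space H"
    and sub_br: "\<lbrakk>x \<in> total_space H; y \<in> total_space H\<rbrakk> \<Longrightarrow> br x y \<in> total_space H"
begin

lemma component_subset_total:
  assumes "\<And>i. subspace (V i)"
  shows "V i \<subseteq> total_space V"
proof
  fix x assume x: "x \<in> V i"
  have zero: "0 \<in> V j" for j
    using assms by (rule subspace_0)
  show "x \<in> total_space V"
  proof (cases "i = 0")
    case True
    then have "x = x + 0 \<and> x \<in> V 0 \<and> 0 \<in> V 1"
      using x zero by simp
    then show ?thesis
      unfolding total_space_def by blast
  next
    case False
    then have "x = 0 + x \<and> 0 \<in> V 0 \<and> x \<in> V 1"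
      using x zero by simp
    then show ?thesis
      unfolding total_space_def by blast
  qed
qed

lemma total_sub_subset: "total_space H \<subseteq> total_space L"
  using sub_component unfolding total_space_def by blast

lemma sub_homogeneous:
  assumes "x \<in> total_space H" "x \<in> L i"
  shows "x \<in> H i"
proof -
  obtain y z where yz: "x = y + z" "y \<in> H 0" "z \<in> H 1"
    using assms(1) unfolding total_space_def by blast
  then have yzL: "y \<in> L 0" "z \<in> L 1"
    using sub_component by blast+
  show ?thesis
  proof (cases "i = 0")
    case zero: True
    then have "z \<in> L 0"
      using assms(2) yz(1) yzL(1) subspace_diff[OF subspace_component[of 0], of x y] by simp
    then have "z = 0"
      using direct yzL(2) by blast
    then show ?thesis
      using yz zero by simp
  next
    case False
    then have one: "i = 1"
      by simp
    then have "y \<in> L 1"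
      using one assms(2) yz(1) yzL(2) subspace_diff[OF subspace_component[of 1], of x z] by simp
    then have "y = 0"
      using direct yzL(1) by blast
    then show ?thesis
      using yz one by simp
  qed
qed

lemma sub_hom_lie_superalgebra: "hom_lie_superalgebra scale H br \<alpha>"
proof -
  note HL = subsetD[OF sub_component] and tHL = subsetD[OF total_sub_subset]
    and Ht = subsetD[OF component_subset_total[where V = H, OF sub_subspace]]
  have "\<alpha> x \<in> H i" if "x \<in> H i" for x i
    using sub_homogeneous alpha_even[OF HL[OF that]] sub_alpha Ht[OF that] by (meson image_subset_iff)
  moreover have "br x y \<in> H (i + j)" if "x \<in> H i" "y \<in> H j" for x y i j
    by (rule sub_homogeneous[OF sub_br[OF Ht Ht] br_even[OF HL HL]]) (fact that)+
  moreover have "H 0 \<inter> H 1 = {0}"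
    using sub_component[of 0] sub_component[of 1] direct
      subspace_0[OF sub_subspace[of 0]] subspace_0[OF sub_subspace[of 1]] by auto
  ultimately show ?thesis
    by (intro hom_lie_superalgebra.intro linear_superspace.intro linear_superspace_axioms.intro
        hom_lie_superalgebra_axioms.intro vector_space_axioms)
      (rule sub_subspace alpha_linear tHL br_linear_left br_linear_right br_skew HL hom_jacobi
        | assumption)+
qed

end

definition fixed_even :: "(bit \<Rightarrow> 'v set) \<Rightarrow> ('v \<Rightarrow> 'v) \<Rightarrow> 'v set" where
  "fixed_even L \<alpha> = {x \<in> L 0. \<alpha> x = x}"

definition ad :: "('v \<Rightarrow> 'v \<Rightarrow> 'v) \<Rightarrow> ('v \<Rightarrow> 'v) \<Rightarrow> 'v \<Rightarrow> 'v \<Rightarrow> 'v" where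
  "ad br \<alpha> a b = br a (\<alpha> b)"

text \<open>
  The type \<open>'v poly\<close> serves as \<open>L[\<lambda>] = L \<otimes> F[\<lambda>]\<close>: polynomials in an indeterminate \<open>\<lambda>\<close> with
  coefficients in \<open>L\<close>. The following is the \<open>F[\<lambda>]\<close>-linear extension of
  \<open>ad\<^sub>\<alpha> (\<lambda>x + y) = \<lambda> ad\<^sub>\<alpha> x + ad\<^sub>\<alpha> y\<close>; multiplication by \<open>\<lambda>\<close> is \<open>pCons 0\<close>.
\<close>

definition ad_poly ::
    "('v::ab_group_add \<Rightarrow> 'v \<Rightarrow> 'v) \<Rightarrow> ('v \<Rightarrow> 'v) \<Rightarrow> 'v \<Rightarrow> 'v \<Rightarrow> 'v poly \<Rightarrow> 'v poly" where
  "ad_poly br \<alpha> x y q = pCons 0 (map_poly (ad br \<alpha> x) q) + map_poly (ad br \<alpha> y) q"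

definition s_term ::
    "nat \<Rightarrow> ('f::field \<Rightarrow> 'v::ab_group_add \<Rightarrow> 'v) \<Rightarrow> ('v \<Rightarrow> 'v \<Rightarrow> 'v) \<Rightarrow> ('v \<Rightarrow> 'v) \<Rightarrow>
      nat \<Rightarrow> 'v \<Rightarrow> 'v \<Rightarrow> 'v" where
  "s_term p scale br \<alpha> i x y =
    scale (inverse (of_nat i)) (coeff ((ad_poly br \<alpha> x y ^^ (p - 1)) [:x:]) (i - 1))"

definition p_map ::
    "nat \<Rightarrow> ('f::field \<Rightarrow> 'v::ab_group_add \<Rightarrow> 'v) \<Rightarrow> (bit \<Rightarrow> 'v set) \<Rightarrow>
      ('v \<Rightarrow> 'v \<Rightarrow> 'v) \<Rightarrow> ('v \<Rightarrow> 'v) \<Rightarrow> ('v \<Rightarrow> 'v) \<Rightarrow> bool" where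
  "p_map p scale L br \<alpha> P \<longleftrightarrow>
    P \<in> fixed_even L \<alpha> \<rightarrow> fixed_even L \<alpha> \<and>
    (\<forall>x \<in> fixed_even L \<alpha>. \<forall>b \<in> total_space L. (ad br \<alpha> x ^^ p) b = ad br \<alpha> (P x) b) \<and>
    (\<forall>k. \<forall>x \<in> fixed_even L \<alpha>. P (scale k x) = scale (k ^ p) (P x)) \<and>
    (\<forall>x \<in> fixed_even L \<alpha>. \<forall>y \<in> fixed_even L \<alpha>.
      P (x + y) = P x + P y + (\<Sum>i = 1..p - 1. s_term p scale br \<alpha> i x y))"

locale restricted_hom_lie_superalgebra =
  multiplicative_hom_lie_superalgebra scale L br \<alpha>
  for scale :: "'f::field \<Rightarrow> 'v::ab_group_add \<Rightarrow> 'v" (infixr \<open>*s\<close> 75)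
    and L br \<alpha> +
  fixes p :: nat and P :: "'v \<Rightarrow> 'v"
  assumes p_map: "p_map p scale L br \<alpha> P"

definition centralizer ::
    "(bit \<Rightarrow> 'v::ab_group_add set) \<Rightarrow> ('v \<Rightarrow> 'v \<Rightarrow> 'v) \<Rightarrow> ('v \<Rightarrow> 'v) \<Rightarrow> 'v set \<Rightarrow> 'v set" where
  "centralizer L br \<alpha> S = {x \<in> total_space L. \<forall>y \<in> S. br x (\<alpha> y) = 0}"

definition p_semilinear_on ::
    "nat \<Rightarrow> ('f::field \<Rightarrow> 'v::ab_group_add \<Rightarrow> 'v) \<Rightarrow> 'v set \<Rightarrow> ('v \<Rightarrow> 'v) \<Rightarrow> bool" where
  "p_semilinear_on p scale D f \<longleftrightarrow>
    (\<forall>k. \<forall>x \<in> D. \<forall>y \<in> D. f (scale k x + y) = scale (k ^ p) (f x) + f y)"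

end

theory Submission
  imports Defs
begin

text \<open>The p-maps on \<open>H\<close> form an affine space. The operator power
  \<open>(ad br \<alpha> x ^^ p)\<close> and the terms \<open>s_term\<close> are built from the
  bracket and \<alpha> alone, so they are the same for \<open>P\<close> and \<open>P1\<close>.
  Subtracting the axioms for \<open>P\<close> from those for \<open>P1\<close> therefore leaves
  homogeneous conditions on f = P1 - P: condition (1) says that f x centralizes \<open>H\<close>,
  while (2) and (3) say that f is p-semilinear. Conversely, adding such an f to \<open>P\<close>
  preserves all three identities. The two subspace lemmas keep the sums, multiples and differences
  involved inside the domains where the axioms apply.\<close>

lemma (in linear_superspace) subspace_total_space: "subspace (total_space L)"
  using subspace_sums[OF subspace_component[of 0] subspace_component[of 1]]
  unfolding total_space_def .

text \<open>The fixed points of a linear map form a subspace. Stated for an arbitrary Hom-Lie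
  superalgebra so that it applies to \<open>H\<close>: there it closes the domain of
  \<open>P1\<close> under addition and scaling.\<close>

lemma (in hom_lie_superalgebra) subspace_fixed_even: "subspace (fixed_even L \<alpha>)"
proof -
  have L0: "x \<in> total_space L" if "x \<in> L 0" for x
    using that subspace_0[OF subspace_component[of 1]]
    unfolding total_space_def by force
  have lin: "\<alpha> (k *s x + y) = k *s \<alpha> x + \<alpha> y" if "x \<in> L 0" "y \<in> L 0" for k x y
    using that L0 alpha_linear by blast
  have zero: "0 \<in> L 0"
    using subspace_0[OF subspace_component] .
  \<comment> \<open>Linearity comes in the combined form k x + y; once \<alpha> 0 = 0 is known, y =
    0 gives homogeneity and k = 1 additivity.\<close>
  have "\<alpha> 0 = 0"
    using lin[OF zero zero, of 1] by simp
  then show ?thesis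
    using zero lin[of _ _ 1] lin[OF _ zero]
      subspace_add[OF subspace_component] subspace_scale[OF subspace_component]
    unfolding subspace_def fixed_even_def by auto
qed

theorem theorem1:
  fixes scale :: "'f::field \<Rightarrow> 'v::ab_group_add \<Rightarrow> 'v"
    and L H :: "bit \<Rightarrow> 'v set"
    and br :: "'v \<Rightarrow> 'v \<Rightarrow> 'v" and \<alpha> :: "'v \<Rightarrow> 'v"
    and p :: nat and P P1 :: "'v \<Rightarrow> 'v"
  assumes "CHAR('f) = p" and "p > 0" and "p \<noteq> 2" and "p \<noteq> 3"
    and "restricted_hom_lie_superalgebra scale L br \<alpha> p P"
    and "hom_lie_subsuperalgebra scale L br \<alpha> H"
    and "P1 \<in> fixed_even H \<alpha> \<rightarrow> fixed_even H \<alpha>"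
  shows "p_map p scale H br \<alpha> P1 \<longleftrightarrow>
    (\<exists>f. f \<in> fixed_even H \<alpha> \<rightarrow> centralizer L br \<alpha> (total_space H) \<and>
         p_semilinear_on p scale (fixed_even H \<alpha>) f \<and>
         (\<forall>x \<in> fixed_even H \<alpha>. P1 x = P x + f x))"
proof -
  interpret restricted_hom_lie_superalgebra scale L br \<alpha> p P by fact
  interpret sub: hom_lie_subsuperalgebra scale L br \<alpha> H by fact
  interpret H: hom_lie_superalgebra scale H br \<alpha>
    by (rule sub.sub_hom_lie_superalgebra)
  \<comment> \<open>\<open>s_term\<close> takes no carrier, so this one sum is the correction term
    over both \<open>L\<close> and \<open>H\<close>.\<close>
  let ?S = "\<lambda>x y. \<Sum>i = 1..p - 1. s_term p scale br \<alpha> i x y"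
  have sub_fixed: "x \<in> fixed_even L \<alpha>" if "x \<in> fixed_even H \<alpha>" for x
    using that sub.sub_component unfolding fixed_even_def by blast
  have fixed_total: "x \<in> total_space L" if "x \<in> fixed_even L \<alpha>" for x
    using that sub.component_subset_total[of L 0] subspace_component
    unfolding fixed_even_def by blast
  have P_fixed: "P x \<in> fixed_even L \<alpha>"
    and P_ad: "b \<in> total_space L \<Longrightarrow> (ad br \<alpha> x ^^ p) b = br (P x) (\<alpha> b)"
    and P_scale: "P (scale k x) = scale (k ^ p) (P x)"
    if "x \<in> fixed_even H \<alpha>" for x b k
    using p_map sub_fixed[OF that] unfolding p_map_def ad_def by auto
  have P_add: "P (x + y) = P x + P y + ?S x y"
    if "x \<in> fixed_even H \<alpha>" "y \<in> fixed_even H \<alpha>" for x y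
    using p_map that[THEN sub_fixed] unfolding p_map_def by blast
  have P1_fixed: "P1 x \<in> fixed_even H \<alpha>" if "x \<in> fixed_even H \<alpha>" for x
    using that assms(7) by blast
  have subL: "b \<in> total_space L" "\<alpha> b \<in> total_space L" if "b \<in> total_space H" for b
    using that sub.total_sub_subset sub.sub_alpha by blast+
  note fixed_add = subspace_add[OF H.subspace_fixed_even]
    and fixed_scale = subspace_scale[OF H.subspace_fixed_even]
  show ?thesis
  proof
    assume P1: "p_map p scale H br \<alpha> P1"
    define f where "f x = P1 x - P x" for x
    have "f x \<in> centralizer L br \<alpha> (total_space H)" if x: "x \<in> fixed_even H \<alpha>" for x
    proof -
      have tot: "P x \<in> total_space L" "P1 x \<in> total_space L"
        using P_fixed P1_fixed sub_fixed fixed_total x by blast+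
      have "br (f x) (\<alpha> b) = 0" if b: "b \<in> total_space H" for b
      proof -
        \<comment> \<open>Both sides equal \<open>(ad br \<alpha> x ^^ p) b\<close>.\<close>
        have "br (P1 x) (\<alpha> b) = br (P x) (\<alpha> b)"
          using P1 x b P_ad[OF x subL(1)[OF b]] unfolding p_map_def ad_def by auto
        then show ?thesis
          using br_linear_left[OF tot subL(2)[OF b], of "- 1"] by (simp add: f_def)
      qed
      moreover have "f x \<in> total_space L"
        unfolding f_def using subspace_diff[OF subspace_total_space] tot by blast
      ultimately show ?thesis
        unfolding centralizer_def by blast
    qed
    moreover have "p_semilinear_on p scale (fixed_even H \<alpha>) f"
      unfolding p_semilinear_on_def
    proof (intro allI ballI)
      fix k x y assume x: "x \<in> fixed_even H \<alpha>" and y: "y \<in> fixed_even H \<alpha>"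
      note kx = fixed_scale[OF x, of k]
      \<comment> \<open>\<open>P_add\<close> produces the same sum \<open>?S (scale k x) y\<close>,
        which cancels in the difference.\<close>
      have "P1 (scale k x + y) = P1 (scale k x) + P1 y + ?S (scale k x) y"
        and "P1 (scale k x) = scale (k ^ p) (P1 x)"
        using P1 x y kx unfolding p_map_def by blast+
      then show "f (scale k x + y) = scale (k ^ p) (f x) + f y"
        by (simp add: f_def P_add[OF kx y] P_scale[OF x] scale_right_diff_distrib)
    qed
    ultimately show "\<exists>f. f \<in> fixed_even H \<alpha> \<rightarrow> centralizer L br \<alpha> (total_space H) \<and>
        p_semilinear_on p scale (fixed_even H \<alpha>) f \<and> (\<forall>x \<in> fixed_even H \<alpha>. P1 x = P x + f x)"
      by (intro exI[of _ f]) (auto simp: f_def)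
  next
    assume "\<exists>f. f \<in> fixed_even H \<alpha> \<rightarrow> centralizer L br \<alpha> (total_space H) \<and>
        p_semilinear_on p scale (fixed_even H \<alpha>) f \<and> (\<forall>x \<in> fixed_even H \<alpha>. P1 x = P x + f x)"
    then obtain f where f_cent: "f \<in> fixed_even H \<alpha> \<rightarrow> centralizer L br \<alpha> (total_space H)"
      and f_semi: "\<And>k x y. x \<in> fixed_even H \<alpha> \<Longrightarrow> y \<in> fixed_even H \<alpha> \<Longrightarrow>
          f (scale k x + y) = scale (k ^ p) (f x) + f y"
      and P1_eq: "\<And>x. x \<in> fixed_even H \<alpha> \<Longrightarrow> P1 x = P x + f x"
      unfolding p_semilinear_on_def by blast
    have zero: "0 \<in> fixed_even H \<alpha>"
      using subspace_0[OF H.subspace_fixed_even] .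
    have f_zero: "f 0 = 0"
      using f_semi[OF zero zero, of 1] by simp
    show "p_map p scale H br \<alpha> P1"
      unfolding p_map_def
    proof (intro conjI allI ballI)
      fix x b assume x: "x \<in> fixed_even H \<alpha>" and b: "b \<in> total_space H"
      \<comment> \<open>\<open>P x\<close> and \<open>f x\<close> need not lie in \<open>H\<close>
        separately, so the bracket is expanded in \<open>L\<close>.\<close>
      have f: "f x \<in> total_space L" "br (f x) (\<alpha> b) = 0"
        using f_cent x b unfolding centralizer_def by blast+
      then show "(ad br \<alpha> x ^^ p) b = ad br \<alpha> (P1 x) b"
        using br_linear_left[OF fixed_total[OF P_fixed[OF x]] f(1) subL(2)[OF b], of 1]
        by (simp add: P_ad[OF x subL(1)[OF b]] ad_def P1_eq[OF x])
    next
      fix k x assume x: "x \<in> fixed_even H \<alpha>"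
      \<comment> \<open>Homogeneity of f is semilinearity at y = 0, with f 0 = 0.\<close>
      then show "P1 (scale k x) = scale (k ^ p) (P1 x)"
        using f_semi[OF x zero, of k]
        by (simp add: P1_eq fixed_scale P_scale f_zero scale_right_distrib)
    next
      fix x y assume "x \<in> fixed_even H \<alpha>" "y \<in> fixed_even H \<alpha>"
      then show "P1 (x + y) = P1 x + P1 y + ?S x y"
        using f_semi[of x y 1] by (simp add: P1_eq fixed_add P_add)
    qed (fact assms(7))
  qed
qed

end
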